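(* Let $A\in\mathbb{R}^{m\times n}$, $b\in\mathbb{R}^m$, $\mu>0$, and $F_2(x):=\frac12\|Ax-b\|^2+\mu\|x\|_1$. There is a constant $\nu>0$ depending only on $A,b,\mu$ such that the following holds. Let $(x^k)_{k\in\mathbb{N}}$ be the sequence generated by ISTA for the Lasso problem $\min_{x\in\mathbb{R}^n}F_2(x)$ that converges to an optimal solution $x^*\in S^*$. Then $$\|x^{k+1}-x^*\|\le\frac{1}{\sqrt{1+\frac{\alpha\gamma_R}{4}}}\|x^k-x^*\|\quad\mbox{and}\quad |F_2(x^{k+1})-F_2(x^* )|\le\frac{\sqrt{1+\frac{\alpha\gamma_R}{4}}+1}{2\sqrt{1+\frac{\alpha\gamma_R}{4}}}\,|F_2(x^k)-F_2(x^* )|$$ are satisfied when $k$ is sufficiently large, where $\alpha=\min\left\{\frac{\sigma}{2},\frac{\theta}{2\lambda_{\max}(A^TA)}\right\}$, $R$ is any number bigger than $\frac{\|b\|^2}{2\mu}$, and $$\gamma_R:=\nu^2\left(1+\frac{\sqrt5}{2}\mu R+(R\|A\|+\|b\|)(4R\|A\|+\|b\|)\right)^{-1}.$$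
   Context: $S^*$ is the set of minimizers of $F_2$; $\lambda_{\max}(A^TA)$ is the largest eigenvalue of $A^TA$ (the quotient $\theta/(2\lambda_{\max}(A^TA))$ is $+\infty$ if it is $0$). ISTA is the forward-backward splitting method with Beck–Teboulle line search for $f(x)=\frac12\|Ax-b\|^2$ and $g=\mu\|\cdot\|_1$, i.e.: let $\mathrm{prox}_{\alpha g}:=(\mathrm{Id}+\alpha\partial g)^{-1}$ and $J(x,\alpha):=\mathrm{prox}_{\alpha g}(x-\alpha\nabla f(x))$. The line search $LS(x,\sigma,\theta)$ with $\sigma>0$, $\theta\in(0,1)$ starts with $\alpha=\sigma$; while $f(J(x,\alpha))>f(x)+\langle\nabla f(x),J(x,\alpha)-x\rangle+\frac{1}{2\alpha}\|x-J(x,\alpha)\|^2$ it replaces $\alpha$ by $\theta\alpha$; it outputs $\alpha$. Fix $\sigma>0$, $\theta\in(0,1)$, $x^0\in\mathbb{R}^n$, set $\alpha_{-1}:=\sigma$, and for $k=0,1,2,\dots$ set $\alpha_k:=LS(x^k,\alpha_{k-1},\theta)$ and $x^{k+1}:=J(x^k,\alpha_k)$. *)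

theory Defs
  imports "HOL-Analysis.Analysis" "HOL-Library.While_Combinator"
begin

definition gradient :: "('a::real_inner \<Rightarrow> real) \<Rightarrow> 'a \<Rightarrow> 'a" where
  "gradient f x = (THE D. GDERIV f x :> D)"

definition subdifferential :: "('a::real_inner \<Rightarrow> real) \<Rightarrow> 'a \<Rightarrow> 'a set" where
  "subdifferential g x = {v. \<forall>y. g y \<ge> g x + v \<bullet> (y - x)}"

text \<open>The resolvent \<open>(Id + \<alpha> \<partial>g)\<^sup>-\<^sup>1\<close>: the unique \<open>p\<close> with \<open>z \<in> p + \<alpha> \<partial>g(p)\<close>. It is single-valued
  and defined everywhere when \<open>g\<close> is convex and continuous and \<open>\<alpha> > 0\<close>.\<close>

definition prox :: "real \<Rightarrow> ('a::real_inner \<Rightarrow> real) \<Rightarrow> 'a \<Rightarrow> 'a" where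
  "prox \<alpha> g z = (THE p. \<exists>v \<in> subdifferential g p. p + \<alpha> *\<^sub>R v = z)"

definition forward_backward ::
  "('a::real_inner \<Rightarrow> real) \<Rightarrow> ('a \<Rightarrow> real) \<Rightarrow> 'a \<Rightarrow> real \<Rightarrow> 'a" where
  "forward_backward f g x \<alpha> = prox \<alpha> g (x - \<alpha> *\<^sub>R gradient f x)"

definition line_search ::
  "('a::real_inner \<Rightarrow> real) \<Rightarrow> ('a \<Rightarrow> real) \<Rightarrow> 'a \<Rightarrow> real \<Rightarrow> real \<Rightarrow> real" where
  "line_search f g x \<sigma> \<theta> =
     while
       (\<lambda>\<alpha>. let y = forward_backward f g x \<alpha>
            in f y > f x + gradient f x \<bullet> (y - x) + 1 / (2 * \<alpha>) * (norm (x - y))\<^sup>2)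
       (\<lambda>\<alpha>. \<theta> * \<alpha>)
       \<sigma>"

text \<open>The state after \<open>k\<close> iterations is the pair \<open>(x\<^sup>k, \<alpha>\<^sub>k\<^sub>-\<^sub>1)\<close>, where \<open>\<alpha>\<^sub>-\<^sub>1 = \<sigma>\<close>.\<close>

primrec fbs_state ::
  "('a::real_inner \<Rightarrow> real) \<Rightarrow> ('a \<Rightarrow> real) \<Rightarrow> real \<Rightarrow> real \<Rightarrow> 'a \<Rightarrow> nat \<Rightarrow> 'a \<times> real" where
  "fbs_state f g \<sigma> \<theta> x0 0 = (x0, \<sigma>)"
| "fbs_state f g \<sigma> \<theta> x0 (Suc k) =
     (let (x, \<alpha>) = fbs_state f g \<sigma> \<theta> x0 k;
          \<alpha>' = line_search f g x \<alpha> \<theta>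
      in (forward_backward f g x \<alpha>', \<alpha>'))"

definition l1_norm :: "real ^ 'n \<Rightarrow> real" where
  "l1_norm x = (\<Sum>i\<in>UNIV. \<bar>x $ i\<bar>)"

definition least_squares :: "real ^ 'n ^ 'm \<Rightarrow> real ^ 'm \<Rightarrow> real ^ 'n \<Rightarrow> real" where
  "least_squares A b x = 1 / 2 * (norm (A *v x - b))\<^sup>2"

definition lasso :: "real ^ 'n ^ 'm \<Rightarrow> real ^ 'm \<Rightarrow> real \<Rightarrow> real ^ 'n \<Rightarrow> real" where
  "lasso A b \<mu> x = least_squares A b x + \<mu> * l1_norm x"

definition minimizers :: "('a \<Rightarrow> real) \<Rightarrow> 'a set" where
  "minimizers F = {x. \<forall>y. F x \<le> F y}"

definition ista ::
  "real ^ 'n ^ 'm \<Rightarrow> real ^ 'm \<Rightarrow> real \<Rightarrow> real \<Rightarrow> real \<Rightarrow> real ^ 'n \<Rightarrow> nat \<Rightarrow> real ^ 'n" where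
  "ista A b \<mu> \<sigma> \<theta> x0 k =
     fst (fbs_state (least_squares A b) (\<lambda>x. \<mu> * l1_norm x) \<sigma> \<theta> x0 k)"

definition lambda_max :: "real ^ 'n ^ 'n \<Rightarrow> real" where
  "lambda_max M = Max {l. \<exists>v. v \<noteq> 0 \<and> M *v v = l *\<^sub>R v}"

text \<open>The quotient \<open>\<theta> / (2 lambda_max (transpose A ** A))\<close> is read as \<open>\<infinity>\<close> when its denominator vanishes.\<close>

definition step_bound :: "real ^ 'n ^ 'm \<Rightarrow> real \<Rightarrow> real \<Rightarrow> real" where
  "step_bound A \<sigma> \<theta> =
     (let L = lambda_max (transpose A ** A)
      in if L = 0 then \<sigma> / 2 else min (\<sigma> / 2) (\<theta> / (2 * L)))"

text \<open>\<open>\<parallel>A\<parallel>\<close> is the spectral norm; \<open>norm A\<close> would be the Frobenius norm.\<close>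

definition growth_const ::
  "real ^ 'n ^ 'm \<Rightarrow> real ^ 'm \<Rightarrow> real \<Rightarrow> real \<Rightarrow> real \<Rightarrow> real" where
  "growth_const A b \<mu> \<nu> R =
     (let a = onorm ((*v) A)
      in \<nu>\<^sup>2 * inverse (1 + sqrt 5 / 2 * \<mu> * R + (R * a + norm b) * (4 * R * a + norm b)))"

end

theory Submission
  imports Defs
begin

text \<open>
  Each forward-backward step whose step size \<open>\<alpha>\<close> passed the line search satisfies, for every \<open>y\<close>,
  \<open>\<parallel>x\<^sup>+ - y\<parallel>\<^sup>2 + 2\<alpha>(F x\<^sup>+ - F y) \<le> \<parallel>x - y\<parallel>\<^sup>2\<close> (lemma \<open>ista_step\<close>), and the line search never
  shrinks the step below \<open>min \<sigma> (\<theta> / L)\<close>, where \<open>L\<close> is the largest eigenvalue of \<open>A\<^sup>T A\<close>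
  (below \<open>\<sigma>\<close> if \<open>L = 0\<close>).
  A linear rate follows as soon as \<open>F - min F\<close> dominates a multiple of the squared
  distance to the limit.

  The excess \<open>F - min F\<close> is the sum of \<open>\<parallel>A(x - z)\<parallel>\<^sup>2 / 2\<close> and of nonnegative terms
  \<open>\<mu>\<bar>x\<^sub>i\<bar> - h\<^sub>i x\<^sub>i\<close>, with \<open>z\<close> a fixed minimizer and \<open>h\<close> the negative gradient of the least-squares
  term at \<open>z\<close> (lemma \<open>lasso_excess\<close>). The set \<open>S\<close> of minimizers is therefore a polyhedron, and
  \<open>F - min F \<ge> c dist(x, S)\<^sup>2\<close> near \<open>S\<close> (lemma \<open>lasso_local_quadratic_growth\<close>). Instead of a
  general error bound for polyhedra, the proof uses compactness: if \<open>p\<close> is the projection of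
  \<open>x\<close> to \<open>S\<close>, then \<open>v = x - p\<close> lies in the polar of a cone of feasible directions that depends
  only on the set \<open>J\<close> of vanishing coordinates of \<open>p\<close>. On that polar cone a form that is
  homogeneous of degree 2 and bounds the excess from below vanishes only at 0, so it dominates a
  multiple of \<open>\<parallel>v\<parallel>\<^sup>2\<close>; since there are finitely many \<open>J\<close>, one \<open>c\<close> serves all of them.

  The distance to the whole of \<open>S\<close> controls the distance to the limit \<open>x\<^sup>*\<close> because the
  iterates approach every minimizer \<open>p\<close> monotonically: \<open>\<parallel>x\<^sup>* - p\<parallel> \<le> \<parallel>x\<^sup>k - p\<parallel>\<close>, whence
  \<open>\<parallel>x\<^sup>k - x\<^sup>*\<parallel> \<le> 2 dist(x\<^sup>k, S)\<close>. This yields the rate for the iterates directly, and the rate for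
  the function values after an elementary computation (lemma \<open>function_value_contraction\<close>).

  Since the denominator in \<open>growth_const\<close> is at least 1, its value is at most \<open>\<nu>\<^sup>2\<close>, and both
  claimed factors get larger as \<open>growth_const\<close> gets smaller. Hence the choice \<open>\<nu> = sqrt c\<close> works
  for all \<open>R\<close> at once.
\<close>

section \<open>The least-squares term\<close>

lemma gradient_eqI:
  assumes "GDERIV f x :> D"
  shows "gradient f x = D"
  unfolding gradient_def
proof (rule the_equality)
  show "GDERIV f x :> D" by (rule assms)
next
  fix D' assume "GDERIV f x :> D'"
  with assms have "(\<lambda>h. h \<bullet> D') = (\<lambda>h. h \<bullet> D)"
    unfolding gderiv_def by (rule has_derivative_unique[rotated])
  then show "D' = D"
    by (simp add: fun_eq_iff vector_eq_ldot)
qed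

lemma gradient_least_squares:
  fixes A :: "real ^ 'n ^ 'm"
  shows "gradient (least_squares A b) x = (A *v x - b) v* A"
proof (rule gradient_eqI)
  have lin: "((\<lambda>x. A *v x - b) has_derivative (\<lambda>h. A *v h)) (at x)"
    using has_derivative_diff[OF bounded_linear_imp_has_derivative[OF
        matrix_vector_mul_bounded_linear[of A]] has_derivative_const[of b]] by simp
  have "((\<lambda>x. 1 / 2 * ((A *v x - b) \<bullet> (A *v x - b))) has_derivative
      (\<lambda>h. 1 / 2 * ((A *v x - b) \<bullet> (A *v h) + (A *v h) \<bullet> (A *v x - b)))) (at x)"
    by (intro has_derivative_mult_right has_derivative_inner lin)
  then have "((\<lambda>x. 1 / 2 * ((A *v x - b) \<bullet> (A *v x - b))) has_derivative
      (\<lambda>h. h \<bullet> ((A *v x - b) v* A))) (at x)"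
    by (rule has_derivative_eq_rhs)
      (simp add: fun_eq_iff inner_commute[of _ "(A *v x - b) v* A"] dot_lmul_matrix
        inner_commute[of _ "A *v x - b"])
  then show "GDERIV (least_squares A b) x :> (A *v x - b) v* A"
    unfolding gderiv_def least_squares_def[abs_def] power2_norm_eq_inner .
qed

lemma least_squares_expand:
  fixes A :: "real ^ 'n ^ 'm"
  shows "least_squares A b y = least_squares A b x + gradient (least_squares A b) x \<bullet> (y - x)
    + 1 / 2 * (norm (A *v (y - x)))\<^sup>2"
proof -
  have "A *v y - b = (A *v x - b) + A *v (y - x)"
    by (simp add: matrix_vector_mult_diff_distrib)
  moreover have "(norm (u + w))\<^sup>2 = (norm u)\<^sup>2 + 2 * (u \<bullet> w) + (norm w)\<^sup>2" for u w :: "real ^ 'm"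
    by (simp add: power2_norm_eq_inner inner_add_left inner_add_right inner_commute)
  ultimately have "(norm (A *v y - b))\<^sup>2 = (norm (A *v x - b))\<^sup>2
      + 2 * ((A *v x - b) \<bullet> (A *v (y - x))) + (norm (A *v (y - x)))\<^sup>2"
    by metis
  then show ?thesis
    by (simp add: least_squares_def gradient_least_squares dot_lmul_matrix)
qed

section \<open>The proximal map of the l1 norm\<close>

text \<open>The two conditions say \<open>v\<^sub>i \<in> \<partial>(\<mu>\<bar>\<cdot>\<bar>)(p\<^sub>i)\<close>; a sum of functions of separate coordinates is
  treated coordinatewise.\<close>

lemma scaled_l1_subgradient:
  assumes "\<And>i. \<bar>v $ i\<bar> \<le> \<mu>" "\<And>i. v $ i * p $ i = \<mu> * \<bar>p $ i\<bar>"
  shows "v \<in> subdifferential (\<lambda>x. \<mu> * l1_norm x) p"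
proof -
  have le: "\<mu> * \<bar>p $ i\<bar> + v $ i * (y $ i - p $ i) \<le> \<mu> * \<bar>y $ i\<bar>" for y i
  proof -
    have "v $ i * y $ i \<le> \<bar>v $ i\<bar> * \<bar>y $ i\<bar>"
      by (simp add: abs_mult[symmetric])
    also have "\<dots> \<le> \<mu> * \<bar>y $ i\<bar>"
      by (rule mult_right_mono[OF assms(1)]) simp
    finally show ?thesis
      using assms(2)[of i] by (simp add: right_diff_distrib)
  qed
  have "(\<Sum>i\<in>UNIV. \<mu> * \<bar>p $ i\<bar> + v $ i * (y $ i - p $ i)) \<le> (\<Sum>i\<in>UNIV. \<mu> * \<bar>y $ i\<bar>)" for y
    by (rule sum_mono) (rule le)
  then show ?thesis
    by (simp add: subdifferential_def l1_norm_def sum_distrib_left inner_vec_def sum.distrib)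
qed

text \<open>Subdifferentials are monotone, and a monotone operator has a single-valued resolvent.\<close>

lemma resolvent_unique:
  assumes "\<alpha> > 0" "v \<in> subdifferential g p" "p + \<alpha> *\<^sub>R v = z"
    and "v' \<in> subdifferential g p'" "p' + \<alpha> *\<^sub>R v' = z"
  shows "p' = p"
proof -
  have "g p' \<ge> g p + v \<bullet> (p' - p)" "g p \<ge> g p' + v' \<bullet> (p - p')"
    using assms by (auto simp: subdifferential_def)
  then have "(v' - v) \<bullet> (p' - p) \<ge> 0"
    by (simp add: inner_diff_left inner_diff_right)
  moreover have "p' - p = \<alpha> *\<^sub>R (v - v')"
    using assms(3,5) by (simp add: algebra_simps)
  ultimately have "(v' - v) \<bullet> (v' - v) \<le> 0"
    using \<open>\<alpha> > 0\<close> by (simp add: inner_diff_left inner_diff_right inner_commute zero_le_mult_iff)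
  then have "v' = v"
    by (metis inner_eq_zero_iff inner_ge_zero order_antisym right_minus_eq)
  with \<open>p' - p = _\<close> show ?thesis by simp
qed

text \<open>The point is soft thresholding: the subgradient is \<open>z / \<alpha>\<close> clipped to \<open>[-\<mu>, \<mu>]\<close> in each
  coordinate. This turns the definite description in \<open>prox\<close> into a usable property.\<close>

lemma prox_scaled_l1:
  fixes z :: "real ^ 'n"
  assumes "\<alpha> > 0" "\<mu> \<ge> 0"
  shows "\<exists>v \<in> subdifferential (\<lambda>x. \<mu> * l1_norm x) (prox \<alpha> (\<lambda>x. \<mu> * l1_norm x) z).
    prox \<alpha> (\<lambda>x. \<mu> * l1_norm x) z + \<alpha> *\<^sub>R v = z"
proof -
  define v :: "real ^ 'n" where "v = (\<chi> i. max (- \<mu>) (min \<mu> (z $ i / \<alpha>)))"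
  define p where "p = z - \<alpha> *\<^sub>R v"
  have "\<bar>v $ i\<bar> \<le> \<mu>" for i
    using assms by (auto simp: v_def)
  moreover have "v $ i * p $ i = \<mu> * \<bar>p $ i\<bar>" for i
  proof -
    consider "z $ i / \<alpha> > \<mu>" | "z $ i / \<alpha> < - \<mu>" | "- \<mu> \<le> z $ i / \<alpha>" "z $ i / \<alpha> \<le> \<mu>"
      by linarith
    then show ?thesis
    proof cases
      case 1
      then have "v $ i = \<mu>"
        using assms by (simp add: v_def)
      moreover have "\<alpha> * \<mu> < z $ i"
        using 1 assms by (simp add: less_divide_eq mult.commute)
      ultimately show ?thesis by (simp add: p_def)
    next
      case 2
      then have "v $ i = - \<mu>"
        using assms by (simp add: v_def)
      moreover have "z $ i < - (\<alpha> * \<mu>)"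
        using 2 assms by (simp add: divide_less_eq mult.commute)
      ultimately show ?thesis by (simp add: p_def algebra_simps)
    next
      case 3
      then have "v $ i = z $ i / \<alpha>"
        by (simp add: v_def)
      then show ?thesis using assms by (simp add: p_def)
    qed
  qed
  ultimately have v: "v \<in> subdifferential (\<lambda>x. \<mu> * l1_norm x) p"
    by (rule scaled_l1_subgradient)
  have pz: "p + \<alpha> *\<^sub>R v = z" by (simp add: p_def)
  have "\<exists>!p. \<exists>v \<in> subdifferential (\<lambda>x. \<mu> * l1_norm x) p. p + \<alpha> *\<^sub>R v = z"
    using v pz resolvent_unique[OF assms(1) v pz] by blast
  then show ?thesis
    unfolding prox_def by (rule theI')
qed

section \<open>The largest eigenvalue\<close>

lemma gram_inner:
  fixes A :: "real ^ 'n ^ 'm"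
  shows "((transpose A ** A) *v v) \<bullet> w = (A *v v) \<bullet> (A *v w)"
  by (simp add: matrix_vector_mul_assoc[symmetric] dot_lmul_matrix)

text \<open>Finiteness makes the maximum in \<open>lambda_max\<close> meaningful. Eigenvectors of a symmetric matrix
  for distinct eigenvalues are orthogonal, and an orthogonal family in a Euclidean space is finite.\<close>

lemma finite_gram_eigenvalues:
  fixes A :: "real ^ 'n ^ 'm"
  shows "finite {l. \<exists>v. v \<noteq> 0 \<and> (transpose A ** A) *v v = l *\<^sub>R v}" (is "finite ?E")
proof -
  define e where "e l = (SOME v. v \<noteq> 0 \<and> (transpose A ** A) *v v = l *\<^sub>R v)" for l
  have e: "e l \<noteq> 0" "(transpose A ** A) *v e l = l *\<^sub>R e l" if "l \<in> ?E" for l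
    using that someI_ex[of "\<lambda>v. v \<noteq> 0 \<and> (transpose A ** A) *v v = l *\<^sub>R v"]
    unfolding e_def by auto
  have orth: "e l \<bullet> e l' = 0" if "l \<in> ?E" "l' \<in> ?E" "l \<noteq> l'" for l l'
  proof -
    have "l * (e l \<bullet> e l') = l' * (e l \<bullet> e l')"
      using gram_inner[of A "e l" "e l'"] gram_inner[of A "e l'" "e l"] e that
      by (simp add: inner_commute)
    with that show ?thesis by simp
  qed
  have "inj_on e ?E"
    using orth e(1) by (metis (no_types, lifting) inj_onI inner_eq_zero_iff)
  moreover have "finite (e ` ?E)"
    by (rule pairwise_orthogonal_imp_finite)
      (use orth in \<open>auto simp: pairwise_def orthogonal_def\<close>)
  ultimately show ?thesis
    using finite_imageD by blast
qed

text \<open>The form \<open>L \<parallel>w\<parallel>\<^sup>2 - \<parallel>A w\<parallel>\<^sup>2\<close> is nonnegative and attains its minimum 0 at \<open>v\<close>, so its gradient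
  vanishes there. The gradient is \<open>2 u\<close> for \<open>u = L v - A\<^sup>T A v\<close>; a small step from \<open>v\<close> against \<open>u\<close>
  would otherwise make the form negative.\<close>

lemma quadratic_form_zero_imp_eigenvector:
  fixes A :: "real ^ 'n ^ 'm"
  assumes le: "\<And>w. (norm (A *v w))\<^sup>2 \<le> L * (norm w)\<^sup>2"
    and eq: "(norm (A *v v))\<^sup>2 = L * (norm v)\<^sup>2"
  shows "(transpose A ** A) *v v = L *\<^sub>R v"
proof -
  define u where "u = L *\<^sub>R v - (transpose A ** A) *v v"
  define q where "q = L * (norm u)\<^sup>2 - (norm (A *v u))\<^sup>2"
  have nonneg: "0 \<le> 2 * t * (norm u)\<^sup>2 + t\<^sup>2 * q" for t
  proof -
    have "0 \<le> L * (norm (v + t *\<^sub>R u))\<^sup>2 - (norm (A *v (v + t *\<^sub>R u)))\<^sup>2"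
      using le[of "v + t *\<^sub>R u"] by simp
    also have "\<dots> = 2 * t * (L * (v \<bullet> u) - (A *v v) \<bullet> (A *v u)) + t\<^sup>2 * q"
      using eq unfolding q_def power2_norm_eq_inner
      by (simp add: matrix_vector_right_distrib matrix_vector_mult_scaleR inner_add_left
          inner_add_right inner_commute power2_eq_square algebra_simps)
    also have "L * (v \<bullet> u) - (A *v v) \<bullet> (A *v u) = (norm u)\<^sup>2"
      unfolding gram_inner[symmetric] power2_norm_eq_inner
      by (subst (3) u_def) (simp add: inner_diff_left)
    finally show ?thesis .
  qed
  have "u = 0"
  proof (rule ccontr)
    assume "u \<noteq> 0"
    have "q \<ge> 0"
      using le[of u] by (simp add: q_def)
    \<comment> \<open>minimizes \<open>2 t \<parallel>u\<parallel>\<^sup>2 + t\<^sup>2 (q + 1)\<close>; the added 1 covers the case \<open>q = 0\<close>\<close>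
    define t where "t = - (norm u)\<^sup>2 / (q + 1)"
    have "2 * t * (norm u)\<^sup>2 + t\<^sup>2 * q = - ((norm u)\<^sup>2)\<^sup>2 * (q + 2) / (q + 1)\<^sup>2"
      using \<open>q \<ge> 0\<close> unfolding t_def
      by (simp add: divide_simps power2_eq_square) (simp add: algebra_simps)
    moreover have "\<dots> < 0"
      using \<open>q \<ge> 0\<close> \<open>u \<noteq> 0\<close> by (auto intro!: divide_neg_pos mult_pos_pos)
    ultimately show False using nonneg[of t] by linarith
  qed
  then show ?thesis by (simp add: u_def)
qed

text \<open>The maximum of \<open>\<parallel>A v\<parallel>\<^sup>2\<close> over the unit sphere is attained and is an eigenvalue of \<open>A\<^sup>T A\<close>, hence at
  most \<open>lambda_max\<close>.\<close>

lemma norm_matrix_le_lambda_max: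
  fixes A :: "real ^ 'n ^ 'm"
  shows "(norm (A *v w))\<^sup>2 \<le> lambda_max (transpose A ** A) * (norm w)\<^sup>2"
    and "0 \<le> lambda_max (transpose A ** A)"
proof -
  have "continuous_on (sphere 0 1) (\<lambda>v. (norm (A *v v))\<^sup>2)"
    by (intro continuous_intros)
  then obtain v where v: "norm v = 1" "\<And>w. norm w = 1 \<Longrightarrow> (norm (A *v w))\<^sup>2 \<le> (norm (A *v v))\<^sup>2"
    using continuous_attains_sup[of "sphere (0::real^'n) 1" "\<lambda>v. (norm (A *v v))\<^sup>2"]
    by (auto simp: sphere_eq_empty)
  define L where "L = (norm (A *v v))\<^sup>2"
  have le: "(norm (A *v w))\<^sup>2 \<le> L * (norm w)\<^sup>2" for w
  proof (cases "w = 0")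
    case False
    have "A *v w = norm w *\<^sub>R (A *v ((1 / norm w) *\<^sub>R w))"
      using False by (simp add: matrix_vector_mult_scaleR)
    then have "(norm (A *v w))\<^sup>2 = (norm w)\<^sup>2 * (norm (A *v ((1 / norm w) *\<^sub>R w)))\<^sup>2"
      by (metis abs_norm_cancel norm_scaleR power_mult_distrib)
    also have "\<dots> \<le> (norm w)\<^sup>2 * L"
      unfolding L_def using False by (intro mult_left_mono v) auto
    finally show ?thesis by (simp add: mult.commute)
  qed simp
  have "(transpose A ** A) *v v = L *\<^sub>R v"
    by (rule quadratic_form_zero_imp_eigenvector[OF le]) (simp add: L_def v)
  moreover have "v \<noteq> 0"
    using v(1) by auto
  ultimately have "L \<le> lambda_max (transpose A ** A)"
    unfolding lambda_max_def by (intro Max_ge finite_gram_eigenvalues) blast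
  then show "(norm (A *v w))\<^sup>2 \<le> lambda_max (transpose A ** A) * (norm w)\<^sup>2"
    by (meson le mult_right_mono order_trans zero_le_power2)
  show "0 \<le> lambda_max (transpose A ** A)"
    using \<open>L \<le> lambda_max (transpose A ** A)\<close> by (rule order_trans[rotated]) (simp add: L_def)
qed

section \<open>The iteration\<close>

text \<open>Add the subgradient inequality of \<open>g\<close> at \<open>x'\<close> to the lower bound for \<open>f y\<close> and the upper bound for
  \<open>f x'\<close>. The resolvent equation says \<open>\<alpha> (D + v) = x - x'\<close>, and the remaining inner product
  \<open>(x - x') \<bullet> (y - x')\<close> is expressed through squared distances. With \<open>y\<close> a minimizer this is a
  Fejer inequality, with \<open>y = x\<close> it is sufficient decrease.\<close>

lemma forward_backward_descent:
  fixes f g :: "'a::real_inner \<Rightarrow> real"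
  assumes "\<alpha> > 0"
    and v: "v \<in> subdifferential g x'" "x' + \<alpha> *\<^sub>R v = x - \<alpha> *\<^sub>R D"
    and lower: "f x + D \<bullet> (y - x) \<le> f y"
    and upper: "f x' \<le> f x + D \<bullet> (x' - x) + 1 / (2 * \<alpha>) * (norm (x - x'))\<^sup>2"
  shows "(norm (x' - y))\<^sup>2 + 2 * \<alpha> * ((f x' + g x') - (f y + g y)) \<le> (norm (x - y))\<^sup>2"
proof -
  have "g x' + v \<bullet> (y - x') \<le> g y"
    using v(1) by (simp add: subdifferential_def)
  with lower upper have "(f x' + g x') - (f y + g y)
      \<le> - (D + v) \<bullet> (y - x') + 1 / (2 * \<alpha>) * (norm (x - x'))\<^sup>2"
    by (simp add: inner_diff_right inner_diff_left algebra_simps)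
  then have "2 * \<alpha> * ((f x' + g x') - (f y + g y))
      \<le> 2 * \<alpha> * (- (D + v) \<bullet> (y - x') + 1 / (2 * \<alpha>) * (norm (x - x'))\<^sup>2)"
    using \<open>\<alpha> > 0\<close> by simp
  also have "\<dots> = - 2 * ((\<alpha> *\<^sub>R (D + v)) \<bullet> (y - x')) + (norm (x - x'))\<^sup>2"
  proof -
    have "- (D + v) \<bullet> (y - x') = - ((D + v) \<bullet> (y - x'))"
      by (rule inner_minus_left)
    then show ?thesis
      using \<open>\<alpha> > 0\<close> by (simp add: right_diff_distrib)
  qed
  also have "\<alpha> *\<^sub>R (D + v) = x - x'"
    using v(2) by (simp add: algebra_simps)
  finally show ?thesis
    by (simp add: power2_norm_eq_inner inner_diff_left inner_diff_right inner_commute)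
qed

text \<open>For least squares the acceptance test at \<open>\<alpha>\<close> can fail only if \<open>\<alpha> L > 1\<close>, where \<open>L\<close> is the largest
  eigenvalue. A rejected \<open>\<alpha>\<close> therefore satisfies \<open>\<theta> \<alpha> > \<theta> / L\<close>, which keeps the step above \<open>l\<close>, and
  only finitely many rejections are possible. Writing the hypothesis as \<open>L l \<le> \<theta>\<close> includes the case
  \<open>L = 0\<close>.\<close>

lemma line_search_least_squares:
  fixes A :: "real ^ 'n ^ 'm" and b :: "real ^ 'm" and a l \<theta> :: real and x :: "real ^ 'n"
    and g :: "real ^ 'n \<Rightarrow> real"
  defines "f \<equiv> least_squares A b"
  assumes "0 < \<theta>" "\<theta> < 1" "0 < l" "l \<le> a"
    and l: "lambda_max (transpose A ** A) * l \<le> \<theta>"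
  defines "a' \<equiv> line_search f g x a \<theta>"
  defines "y \<equiv> forward_backward f g x a'"
  shows "l \<le> a' \<and> f y \<le> f x + gradient f x \<bullet> (y - x) + 1 / (2 * a') * (norm (x - y))\<^sup>2"
proof -
  define L where "L = lambda_max (transpose A ** A)"
  define fails where "fails a \<longleftrightarrow> (let y = forward_backward f g x a
      in f y > f x + gradient f x \<bullet> (y - x) + 1 / (2 * a) * (norm (x - y))\<^sup>2)" for a
  \<comment> \<open>how many more shrinkings guarantee acceptance: the variant of the loop\<close>
  define m where "m a = (LEAST n. \<theta> ^ n * a * L \<le> 1)" for a
  have too_long: "1 < a * L" if "fails a" "l \<le> a" for a
  proof -
    have "a > 0" using that \<open>0 < l\<close> by simp
    define d where "d = forward_backward f g x a - x"
    have "1 / (2 * a) * (norm d)\<^sup>2 < 1 / 2 * (norm (A *v d))\<^sup>2"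
      using \<open>fails a\<close> least_squares_expand[of A b "forward_backward f g x a" x]
      by (simp add: fails_def Let_def f_def d_def norm_minus_commute)
    also have "\<dots> \<le> 1 / 2 * (L * (norm d)\<^sup>2)"
      using norm_matrix_le_lambda_max(1)[of A d] by (simp add: L_def)
    finally have "(norm d)\<^sup>2 < (a * L) * (norm d)\<^sup>2"
      using \<open>a > 0\<close> by (simp add: field_simps)
    then show ?thesis
      using mult_right_mono[of "a * L" 1 "(norm d)\<^sup>2"] by (cases "1 < a * L") auto
  qed
  have "l \<le> while fails (\<lambda>a. \<theta> * a) a \<and> \<not> fails (while fails (\<lambda>a. \<theta> * a) a)"
  proof (rule while_rule2[where P = "\<lambda>a. l \<le> a" and r = "inv_image less_than m"])
    fix a assume "l \<le> a" "fails a"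
    note aL = too_long[OF \<open>fails a\<close> \<open>l \<le> a\<close>]
    have "L > 0"
      using aL \<open>0 < l\<close> \<open>l \<le> a\<close> norm_matrix_le_lambda_max(2)[of A]
      by (cases "L = 0") (auto simp: L_def)
    have "\<theta> * 1 < \<theta> * (a * L)"
      by (rule mult_strict_left_mono) (use aL \<open>0 < \<theta>\<close> in auto)
    with l have "L * l < L * (\<theta> * a)"
      by (simp add: L_def algebra_simps)
    then have "l \<le> \<theta> * a"
      using \<open>L > 0\<close> by simp
    moreover have "m a = Suc (m (\<theta> * a))"
    proof -
      have "(\<lambda>n. \<theta> ^ n * (a * L)) \<longlonglongrightarrow> 0 * (a * L)"
        using \<open>0 < \<theta>\<close> \<open>\<theta> < 1\<close> by (intro tendsto_mult_right LIMSEQ_power_zero) auto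
      then have "eventually (\<lambda>n. \<theta> ^ n * (a * L) < 1) sequentially"
        by (rule order_tendstoD) simp
      then obtain n where "\<theta> ^ n * a * L \<le> 1"
        by (auto simp: eventually_sequentially mult.assoc intro: less_imp_le)
      then have "m a = Suc (LEAST n. \<theta> ^ Suc n * a * L \<le> 1)"
        unfolding m_def by (rule Least_Suc) (use aL in simp)
      then show ?thesis
        by (simp add: m_def mult_ac)
    qed
    ultimately show "l \<le> \<theta> * a \<and> (\<theta> * a, a) \<in> inv_image less_than m"
      by simp
  qed (use \<open>l \<le> a\<close> in auto)
  then show ?thesis
    unfolding a'_def y_def line_search_def fails_def[abs_def] Let_def by (simp add: not_less)
qed

text \<open>With these facts \<open>l = 2 step_bound\<close> can serve as the lower bound in
  \<open>line_search_least_squares\<close>, first for the initial step \<open>\<sigma>\<close> and then inductively.\<close>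

lemma step_bound_admissible:
  fixes A :: "real ^ 'n ^ 'm"
  assumes "\<sigma> > 0" "0 < \<theta>"
  shows "0 < step_bound A \<sigma> \<theta>" "2 * step_bound A \<sigma> \<theta> \<le> \<sigma>"
    "lambda_max (transpose A ** A) * (2 * step_bound A \<sigma> \<theta>) \<le> \<theta>"
  using assms norm_matrix_le_lambda_max(2)[of A]
  by (auto simp: step_bound_def Let_def min_def field_simps)

lemma ista_step:
  fixes A :: "real ^ 'n ^ 'm" and b :: "real ^ 'm" and x0 :: "real ^ 'n"
    and \<mu> \<sigma> \<theta> :: real
  assumes "\<mu> > 0" "\<sigma> > 0" "0 < \<theta>" "\<theta> < 1"
  defines "x \<equiv> ista A b \<mu> \<sigma> \<theta> x0"
  shows "\<exists>a \<ge> 2 * step_bound A \<sigma> \<theta>. \<forall>y. (norm (x (Suc k) - y))\<^sup>2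
      + 2 * a * (lasso A b \<mu> (x (Suc k)) - lasso A b \<mu> y) \<le> (norm (x k - y))\<^sup>2"
proof -
  define f where "f = least_squares A b"
  define g where "g = (\<lambda>x::real^'n. \<mu> * l1_norm x)"
  define l where "l = 2 * step_bound A \<sigma> \<theta>"
  define st where "st = fbs_state f g \<sigma> \<theta> x0"
  have "l > 0" and "l \<le> \<sigma>" and Ll: "lambda_max (transpose A ** A) * l \<le> \<theta>"
    using step_bound_admissible[OF assms(2,3), of A] by (auto simp: l_def)
  note ls = line_search_least_squares[OF \<open>0 < \<theta>\<close> \<open>\<theta> < 1\<close> \<open>l > 0\<close> _ Ll, of _ b g, folded f_def]
  have st_Suc: "snd (st (Suc k)) = line_search f g (fst (st k)) (snd (st k)) \<theta>"
    "fst (st (Suc k)) = forward_backward f g (fst (st k)) (snd (st (Suc k)))" for k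
    by (simp_all add: st_def split_beta Let_def)
  have l_le: "l \<le> snd (st k)" for k
  proof (induction k)
    case 0
    then show ?case using \<open>l \<le> \<sigma>\<close> by (simp add: st_def)
  next
    case (Suc k)
    then show ?case using ls[OF Suc] by (simp only: st_Suc(1))
  qed
  have x: "x k = fst (st k)" for k
    by (simp add: x_def ista_def st_def f_def g_def)
  define a where "a = snd (st (Suc k))"
  have "l \<le> a" "a > 0"
    using l_le[of "Suc k"] \<open>l > 0\<close> by (auto simp: a_def)
  have upper: "f (x (Suc k)) \<le> f (x k) + gradient f (x k) \<bullet> (x (Suc k) - x k)
      + 1 / (2 * a) * (norm (x k - x (Suc k)))\<^sup>2"
    using ls[OF l_le[of k], of "fst (st k)"] by (simp only: x st_Suc a_def)
  have "x (Suc k) = prox a g (x k - a *\<^sub>R gradient f (x k))"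
    by (simp only: x st_Suc(2) a_def forward_backward_def)
  then obtain v where v: "v \<in> subdifferential g (x (Suc k))"
      "x (Suc k) + a *\<^sub>R v = x k - a *\<^sub>R gradient f (x k)"
    using prox_scaled_l1[OF \<open>a > 0\<close>, of \<mu>] \<open>\<mu> > 0\<close> unfolding g_def by (metis less_imp_le)
  have "(norm (x (Suc k) - y))\<^sup>2 + 2 * a * ((f (x (Suc k)) + g (x (Suc k))) - (f y + g y))
      \<le> (norm (x k - y))\<^sup>2" for y
    by (rule forward_backward_descent[OF \<open>a > 0\<close> v _ upper])
      (simp add: f_def least_squares_expand[of A b y "x k"])
  with \<open>l \<le> a\<close> show ?thesis
    by (auto simp: lasso_def f_def g_def l_def)
qed

section \<open>From descent to contraction factors\<close>

text \<open>Here \<open>d\<close> and \<open>e\<close> are the distances of the new and the old iterate to the limit, \<open>s\<close> is the length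
  of the step, and \<open>\<Phi>'\<close>, \<open>\<Phi>\<close> are the new and old excess. With \<open>P = 2 a \<Phi>'\<close> the hypotheses give
  \<open>(r\<^sup>2 - 1) d\<^sup>2 \<le> P \<le> 2 d s + s\<^sup>2\<close>. Eliminating \<open>d\<close> leaves \<open>(r - 1) P \<le> (r + 1) s\<^sup>2\<close>, so a large excess
  forces a long step, and a long step decreases the excess by \<open>s\<^sup>2 / (2 a)\<close>.\<close>

lemma function_value_contraction:
  fixes \<Phi> \<Phi>' a d e s r :: real
  assumes "a > 0" "r \<ge> 1" "d \<ge> 0" "s \<ge> 0"
    and growth: "(r\<^sup>2 - 1) * d\<^sup>2 \<le> 2 * a * \<Phi>'"
    and fejer: "d\<^sup>2 + 2 * a * \<Phi>' \<le> e\<^sup>2"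
    and triangle: "0 \<le> e" "e \<le> d + s"
    and decrease: "s\<^sup>2 + 2 * a * \<Phi>' \<le> 2 * a * \<Phi>"
  shows "\<Phi>' \<le> (r + 1) / (2 * r) * \<Phi>"
proof -
  define P where "P = 2 * a * \<Phi>'"
  have "e\<^sup>2 \<le> (d + s)\<^sup>2"
    using triangle by (intro power_mono) auto
  with fejer have P: "P \<le> 2 * d * s + s\<^sup>2"
    by (simp add: P_def power2_eq_square algebra_simps)
  \<comment> \<open>the weights make this an equality in the extremal case \<open>s = (r - 1) d\<close>\<close>
  have "2 * ((r - 1) * d) * s \<le> ((r - 1) * d)\<^sup>2 + s\<^sup>2"
    by (rule sum_squares_bound)
  moreover have "(r - 1) * P \<le> (r - 1) * (2 * d * s + s\<^sup>2)"
    using P \<open>r \<ge> 1\<close> by (intro mult_left_mono) auto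
  ultimately have "(r - 1) * P \<le> ((r - 1) * d)\<^sup>2 + r * s\<^sup>2"
    by (simp add: algebra_simps)
  then have "(r + 1) * ((r - 1) * P) \<le> (r + 1) * (((r - 1) * d)\<^sup>2 + r * s\<^sup>2)"
    using \<open>r \<ge> 1\<close> by (intro mult_left_mono) auto
  also have "\<dots> = (r - 1) * ((r\<^sup>2 - 1) * d\<^sup>2) + r * ((r + 1) * s\<^sup>2)"
    by (simp add: power2_eq_square algebra_simps)
  also have "\<dots> \<le> (r - 1) * P + r * ((r + 1) * s\<^sup>2)"
    using growth \<open>r \<ge> 1\<close> by (simp add: P_def mult_left_mono)
  finally have "r * ((r - 1) * P) \<le> r * ((r + 1) * s\<^sup>2)"
    by (simp add: algebra_simps)
  then have "(r - 1) * P \<le> (r + 1) * s\<^sup>2"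
    using \<open>r \<ge> 1\<close> by simp
  also have "\<dots> \<le> (r + 1) * (2 * a * \<Phi> - P)"
    using decrease \<open>r \<ge> 1\<close> by (intro mult_left_mono) (auto simp: P_def)
  finally have "(2 * a) * (2 * r * \<Phi>') \<le> (2 * a) * ((r + 1) * \<Phi>)"
    by (simp add: P_def algebra_simps)
  then have "2 * r * \<Phi>' \<le> (r + 1) * \<Phi>"
    using \<open>a > 0\<close> by (simp only: mult_le_cancel_left_pos mult_pos_pos zero_less_numeral)
  then show ?thesis
    using \<open>r \<ge> 1\<close> by (simp add: field_simps)
qed

section \<open>Quadratic growth of the Lasso objective\<close>

lemma tilted_abs_sublinear:
  fixes \<mu> h s t x y :: real
  assumes "\<mu> \<ge> 0" "s \<ge> 0" "t \<ge> 0"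
  shows "\<mu> * \<bar>s * x + t * y\<bar> - h * (s * x + t * y)
    \<le> s * (\<mu> * \<bar>x\<bar> - h * x) + t * (\<mu> * \<bar>y\<bar> - h * y)"
proof -
  have "\<bar>s * x + t * y\<bar> \<le> s * \<bar>x\<bar> + t * \<bar>y\<bar>"
    using assms abs_triangle_ineq[of "s * x" "t * y"] by (simp add: abs_mult)
  then have "\<mu> * \<bar>s * x + t * y\<bar> \<le> \<mu> * (s * \<bar>x\<bar> + t * \<bar>y\<bar>)"
    using assms by (intro mult_left_mono) auto
  then show ?thesis by (simp add: algebra_simps)
qed

text \<open>Write \<open>F x - F xs = \<parallel>A (x - xs)\<parallel>\<^sup>2 / 2 + \<Gamma> x - \<Gamma> xs\<close> with \<open>\<Gamma> x = \<mu> \<parallel>x\<parallel>\<^sub>1 - h \<bullet> x\<close>. The quadratic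
  term is of second order along segments from \<open>xs\<close>, so optimality of \<open>xs\<close> for \<open>F\<close> makes \<open>xs\<close> a minimizer
  of the convex function \<open>\<Gamma>\<close>. As \<open>\<Gamma>\<close> is positively homogeneous, its minimum is 0. Evaluating \<open>\<Gamma>\<close> on the
  coordinate axes yields the optimality condition \<open>\<bar>h\<^sub>i\<bar> \<le> \<mu>\<close>.\<close>

lemma lasso_excess:
  fixes A :: "real ^ 'n ^ 'm" and b :: "real ^ 'm"
  assumes "\<mu> \<ge> 0" and xs: "xs \<in> minimizers (lasso A b \<mu>)"
  defines "h \<equiv> (b - A *v xs) v* A"
  shows "h $ i * t \<le> \<mu> * \<bar>t\<bar>"
    and "lasso A b \<mu> x - lasso A b \<mu> xs
      = 1 / 2 * (norm (A *v (x - xs)))\<^sup>2 + (\<Sum>i\<in>UNIV. \<mu> * \<bar>x $ i\<bar> - h $ i * x $ i)"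
proof -
  define \<Gamma> where "\<Gamma> x = (\<Sum>i\<in>UNIV. \<mu> * \<bar>x $ i\<bar> - h $ i * x $ i)" for x :: "real ^ 'n"
  have \<Gamma>: "\<Gamma> x = \<mu> * l1_norm x - h \<bullet> x" for x
    by (simp add: \<Gamma>_def l1_norm_def sum_subtractf sum_distrib_left inner_vec_def)
  have "gradient (least_squares A b) xs = - h"
    by (simp add: gradient_least_squares h_def vec_eq_iff vector_matrix_mult_def
        sum_negf[symmetric] algebra_simps)
  then have diff: "lasso A b \<mu> x - lasso A b \<mu> xs
      = 1 / 2 * (norm (A *v (x - xs)))\<^sup>2 + (\<Gamma> x - \<Gamma> xs)" for x
    unfolding lasso_def least_squares_expand[of A b x xs] \<Gamma>
    by (simp add: inner_diff_right algebra_simps)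
  have \<Gamma>_min: "\<Gamma> xs \<le> \<Gamma> x" for x
  proof (rule ccontr)
    assume less: "\<not> \<Gamma> xs \<le> \<Gamma> x"
    define q where "q = (norm (A *v (x - xs)))\<^sup>2"
    define \<delta> where "\<delta> = \<Gamma> xs - \<Gamma> x"
    \<comment> \<open>so short that the quadratic term cannot compensate the decrease \<open>t \<delta>\<close>\<close>
    define t where "t = min 1 (\<delta> / (q + 1))"
    define z where "z = (1 - t) *\<^sub>R xs + t *\<^sub>R x"
    have "\<delta> > 0" "q \<ge> 0"
      using less by (auto simp: \<delta>_def q_def)
    then have t: "0 < t" "t \<le> 1" "t \<le> \<delta> / (q + 1)"
      by (simp_all add: t_def)
    then have t\<delta>: "t * (q + 1) \<le> \<delta>"
      using \<open>q \<ge> 0\<close> by (simp add: pos_le_divide_eq)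
    have "\<Gamma> z \<le> (\<Sum>i\<in>UNIV. (1 - t) * (\<mu> * \<bar>xs $ i\<bar> - h $ i * xs $ i)
        + t * (\<mu> * \<bar>x $ i\<bar> - h $ i * x $ i))"
      unfolding \<Gamma>_def z_def vector_add_component vector_scaleR_component real_scaleR_def
      using \<open>\<mu> \<ge> 0\<close> t by (intro sum_mono tilted_abs_sublinear) auto
    then have "\<Gamma> z \<le> (1 - t) * \<Gamma> xs + t * \<Gamma> x"
      by (simp only: \<Gamma>_def sum.distrib sum_distrib_left)
    moreover have "A *v (z - xs) = t *\<^sub>R (A *v (x - xs))"
    proof -
      have "z - xs = t *\<^sub>R (x - xs)"
        by (simp add: z_def algebra_simps)
      then show ?thesis by (simp add: matrix_vector_mult_scaleR)
    qed
    then have "(norm (A *v (z - xs)))\<^sup>2 = t\<^sup>2 * q"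
      by (simp add: q_def power_mult_distrib)
    moreover have "lasso A b \<mu> xs \<le> lasso A b \<mu> z"
      using xs by (simp add: minimizers_def)
    ultimately have "0 \<le> 1 / 2 * (t\<^sup>2 * q) + ((1 - t) * \<Gamma> xs + t * \<Gamma> x - \<Gamma> xs)"
      using diff[of z] by linarith
    also have "\<dots> = t * (t * q / 2 - \<delta>)"
      by (simp add: \<delta>_def power2_eq_square algebra_simps)
    finally have "\<delta> \<le> t * q / 2"
      using t by (simp add: zero_le_mult_iff)
    then show False
      using t t\<delta> \<open>q \<ge> 0\<close> \<open>\<delta> > 0\<close> mult_nonneg_nonneg[of t q] by (simp add: distrib_left)
  qed
  have "\<Gamma> (2 *\<^sub>R xs) = 2 * \<Gamma> xs" "\<Gamma> 0 = 0"
    by (simp_all add: \<Gamma>_def sum_distrib_left abs_mult algebra_simps)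
  then have zero: "\<Gamma> xs = 0"
    using \<Gamma>_min[of "2 *\<^sub>R xs"] \<Gamma>_min[of 0] by linarith
  have "\<Gamma> (axis i t) = (\<Sum>j\<in>UNIV. if j = i then \<mu> * \<bar>t\<bar> - h $ i * t else 0)"
    unfolding \<Gamma>_def by (rule sum.cong) (auto simp: axis_def)
  also have "\<dots> = \<mu> * \<bar>t\<bar> - h $ i * t"
    by simp
  finally show "h $ i * t \<le> \<mu> * \<bar>t\<bar>"
    using \<Gamma>_min[of "axis i t"] zero by simp
  show "lasso A b \<mu> x - lasso A b \<mu> xs
      = 1 / 2 * (norm (A *v (x - xs)))\<^sup>2 + (\<Sum>i\<in>UNIV. \<mu> * \<bar>x $ i\<bar> - h $ i * x $ i)"
    using diff[of x] zero by (simp add: \<Gamma>_def)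
qed

text \<open>The right-hand side is continuous and homogeneous of degree 2. Where it vanishes, \<open>v\<close> belongs to
  \<open>T\<close>, and a vector in \<open>T\<close> and in the polar of \<open>T\<close> is 0. So it is positive on the compact set of unit
  vectors in the polar and has a positive minimum there. The penalty terms are squared only to
  obtain this homogeneity.\<close>

lemma quadratic_lower_bound_on_polar:
  fixes A :: "real ^ 'n ^ 'm" and h :: "real ^ 'n" and J :: "'n set" and \<mu> :: real
  defines "T \<equiv> {w. A *v w = 0 \<and> (\<forall>i\<in>J. \<mu> * \<bar>w $ i\<bar> = h $ i * w $ i)}"
  shows "\<exists>c>0. \<forall>v. (\<forall>w\<in>T. v \<bullet> w \<le> 0) \<longrightarrow>
    c * (norm v)\<^sup>2 \<le> 1 / 2 * (norm (A *v v))\<^sup>2 + (\<Sum>i\<in>J. (\<mu> * \<bar>v $ i\<bar> - h $ i * v $ i)\<^sup>2)"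
proof -
  define N where "N = {v. \<forall>w\<in>T. v \<bullet> w \<le> 0}"
  define Q where "Q v = 1 / 2 * (norm (A *v v))\<^sup>2 + (\<Sum>i\<in>J. (\<mu> * \<bar>v $ i\<bar> - h $ i * v $ i)\<^sup>2)" for v
  have Q_nonneg: "Q v \<ge> 0" for v
    by (auto simp: Q_def intro!: add_nonneg_nonneg sum_nonneg)
  have Q_pos: "Q v > 0" if "v \<in> N" "v \<noteq> 0" for v
  proof (rule ccontr)
    assume "\<not> Q v > 0"
    moreover have "0 \<le> (\<Sum>i\<in>J. (\<mu> * \<bar>v $ i\<bar> - h $ i * v $ i)\<^sup>2)"
      by (intro sum_nonneg) auto
    moreover have "0 \<le> (norm (A *v v))\<^sup>2"
      by simp
    ultimately have "(norm (A *v v))\<^sup>2 = 0" and "(\<Sum>i\<in>J. (\<mu> * \<bar>v $ i\<bar> - h $ i * v $ i)\<^sup>2) = 0"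
      unfolding Q_def by linarith+
    then have "v \<in> T"
      by (simp add: T_def sum_nonneg_eq_0_iff)
    then have "v \<bullet> v \<le> 0"
      using that(1) by (simp add: N_def)
    with that(2) inner_gt_zero_iff[of v] show False
      by linarith
  qed
  have Q_scale: "Q (t *\<^sub>R v) = t\<^sup>2 * Q v" if "t \<ge> 0" for t v
  proof -
    have "\<mu> * \<bar>t * v $ i\<bar> - h $ i * (t * v $ i) = t * (\<mu> * \<bar>v $ i\<bar> - h $ i * v $ i)" for i
      using that by (simp add: abs_mult algebra_simps)
    then show ?thesis
      by (simp add: Q_def matrix_vector_mult_scaleR power_mult_distrib sum_distrib_left distrib_left)
  qed
  have "N = (\<Inter>w\<in>T. {v. w \<bullet> v \<le> 0})"
    by (auto simp: N_def inner_commute)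
  then have "closed N"
    by (auto intro: closed_halfspace_le)
  then have compact: "compact (sphere 0 1 \<inter> N)"
    by (intro compact_Int_closed) auto
  have cont: "continuous_on (sphere 0 1 \<inter> N) Q"
    unfolding Q_def[abs_def] by (intro continuous_intros)
  have "\<exists>c>0. \<forall>v \<in> sphere 0 1 \<inter> N. c \<le> Q v"
  proof (cases "sphere 0 1 \<inter> N = {}")
    case True
    then show ?thesis by (intro exI[of _ 1]) auto
  next
    case False
    then obtain u where "u \<in> sphere 0 1 \<inter> N" "\<forall>v \<in> sphere 0 1 \<inter> N. Q u \<le> Q v"
      using continuous_attains_inf[OF compact _ cont] by blast
    moreover from this have "Q u > 0"
      by (intro Q_pos) auto
    ultimately show ?thesis by blast
  qed
  then obtain c where "c > 0" and c: "\<And>v. v \<in> N \<Longrightarrow> norm v = 1 \<Longrightarrow> c \<le> Q v"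
    by auto
  have "c * (norm v)\<^sup>2 \<le> Q v" if "v \<in> N" for v
  proof (cases "v = 0")
    case False
    define u where "u = (1 / norm v) *\<^sub>R v"
    have v: "v = norm v *\<^sub>R u" and "norm u = 1"
      using False by (auto simp: u_def)
    have "u \<in> N"
      using that by (auto simp: N_def u_def divide_le_0_iff)
    then have "(norm v)\<^sup>2 * c \<le> (norm v)\<^sup>2 * Q u"
      using c \<open>norm u = 1\<close> by (intro mult_left_mono) auto
    also have "\<dots> = Q v"
      using Q_scale[of "norm v" u] v[symmetric] by simp
    finally show ?thesis by (simp add: mult.commute)
  qed (use Q_nonneg in auto)
  with \<open>c > 0\<close> show ?thesis
    unfolding N_def Q_def by blast
qed

text \<open>At coordinates with \<open>p\<^sub>i \<noteq> 0\<close> the hypothesis forces \<open>h\<^sub>i = \<mu> sgn p\<^sub>i\<close>, and the equation persists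
  as long as the sign does not flip; \<open>\<epsilon>\<close> is chosen so that \<open>\<epsilon> \<bar>w\<^sub>i\<bar> \<le> \<bar>p\<^sub>i\<bar>\<close> at all of them. At the other
  coordinates both sides are positively homogeneous in \<open>\<epsilon>\<close>.\<close>

lemma polyhedral_face_tangent:
  fixes h :: "real ^ 'n"
  assumes p: "\<And>i. \<mu> * \<bar>p $ i\<bar> = h $ i * p $ i"
    and w: "\<And>i. p $ i = 0 \<Longrightarrow> \<mu> * \<bar>w $ i\<bar> = h $ i * w $ i"
  shows "\<exists>\<epsilon>>0. \<forall>i. \<mu> * \<bar>(p + \<epsilon> *\<^sub>R w) $ i\<bar> = h $ i * (p + \<epsilon> *\<^sub>R w) $ i"
proof -
  \<comment> \<open>terms with \<open>p $ i = 0\<close> contribute 0, as division by 0 gives 0\<close>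
  define K where "K = (\<Sum>i\<in>UNIV. \<bar>w $ i\<bar> / \<bar>p $ i\<bar>)"
  define \<epsilon> where "\<epsilon> = 1 / (1 + K)"
  have "K \<ge> 0"
    by (auto simp: K_def intro: sum_nonneg)
  then have "\<epsilon> > 0" "\<epsilon> * K \<le> 1"
    by (auto simp: \<epsilon>_def)
  have "\<mu> * \<bar>p $ i + \<epsilon> * w $ i\<bar> = h $ i * (p $ i + \<epsilon> * w $ i)" for i
  proof (cases "p $ i = 0")
    case True
    then show ?thesis
      using w[of i] \<open>\<epsilon> > 0\<close> by (simp add: abs_mult)
  next
    case False
    have "\<bar>w $ i\<bar> / \<bar>p $ i\<bar> \<le> K"
      unfolding K_def by (rule member_le_sum) auto
    then have "\<epsilon> * (\<bar>w $ i\<bar> / \<bar>p $ i\<bar>) \<le> 1"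
      using \<open>\<epsilon> * K \<le> 1\<close> \<open>\<epsilon> > 0\<close> by (meson mult_left_mono less_imp_le order_trans)
    then have "\<bar>\<epsilon> * w $ i\<bar> \<le> \<bar>p $ i\<bar>"
      using False \<open>\<epsilon> > 0\<close> by (simp add: field_simps abs_mult)
    then have "\<bar>p $ i + \<epsilon> * w $ i\<bar> = sgn (p $ i) * (p $ i + \<epsilon> * w $ i)"
      using False by (auto simp: sgn_if abs_if split: if_splits)
    moreover have "h $ i = \<mu> * sgn (p $ i)"
    proof -
      have "h $ i * p $ i = \<mu> * (p $ i * sgn (p $ i))"
        by (simp only: abs_sgn[symmetric] p)
      then have "h $ i * p $ i = (\<mu> * sgn (p $ i)) * p $ i"
        by (simp only: mult_ac)
      then show ?thesis
        by (rule mult_right_cancel[OF False, THEN iffD1])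
    qed
    ultimately show ?thesis by simp
  qed
  with \<open>\<epsilon> > 0\<close> show ?thesis by auto
qed

text \<open>Apply the bound on polar cones to \<open>v = x - p\<close>, where \<open>p\<close> is the projection of \<open>x\<close> to the set of
  minimizers and \<open>J\<close> the set of its vanishing coordinates: every \<open>w \<in> T J\<close> points from \<open>p\<close> into the
  set of minimizers, so \<open>v \<bullet> w \<le> 0\<close>. The radius \<open>1 / (2\<mu>)\<close> keeps each penalty term at most 1, so that
  it dominates its square.\<close>

lemma lasso_local_quadratic_growth:
  fixes A :: "real ^ 'n ^ 'm" and b :: "real ^ 'm"
  assumes "\<mu> > 0"
  defines "F \<equiv> lasso A b \<mu>"
  shows "\<exists>c>0. \<exists>\<delta>>0. \<forall>x. \<forall>xs\<in>minimizers F. norm (x - xs) \<le> \<delta> \<longrightarrow>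
    (\<exists>p\<in>minimizers F. c * (norm (x - p))\<^sup>2 \<le> F x - F p)"
proof (cases "minimizers F = {}")
  case True
  then show ?thesis by (auto intro: exI[of _ 1])
next
  case False
  then obtain z where z: "z \<in> minimizers F" by auto
  define h where "h = (b - A *v z) v* A"
  define G where "G t i = \<mu> * \<bar>t\<bar> - h $ i * t" for t i
  have G_nonneg: "0 \<le> G t i" for t i
    using lasso_excess(1)[OF less_imp_le[OF \<open>\<mu> > 0\<close>] z[unfolded F_def]] by (simp add: G_def h_def)
  have excess: "F x - F z = 1 / 2 * (norm (A *v (x - z)))\<^sup>2 + (\<Sum>i\<in>UNIV. G (x $ i) i)" for x
    unfolding F_def G_def h_def by (rule lasso_excess(2)[OF less_imp_le[OF \<open>\<mu> > 0\<close>] z[unfolded F_def]])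
  have F_min: "F x = F z" if "x \<in> minimizers F" for x
    using that z by (intro order_antisym) (auto simp: minimizers_def)
  have min_iff: "x \<in> minimizers F \<longleftrightarrow> A *v (x - z) = 0 \<and> (\<forall>i. G (x $ i) i = 0)" for x
  proof -
    have "x \<in> minimizers F \<longleftrightarrow> F x - F z = 0"
      using F_min[of x] z by (auto simp: minimizers_def)
    also have "\<dots> \<longleftrightarrow> A *v (x - z) = 0 \<and> (\<forall>i. G (x $ i) i = 0)"
      unfolding excess using G_nonneg
      by (subst add_nonneg_eq_0_iff) (auto simp: sum_nonneg sum_nonneg_eq_0_iff)
    finally show ?thesis .
  qed
  have "convex (minimizers F)"
  proof (rule convexI)
    fix x y s t
    assume x: "x \<in> minimizers F" and y: "y \<in> minimizers F" and st: "0 \<le> s" "0 \<le> t" "s + t = (1::real)"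
    have "A *v (s *\<^sub>R x + t *\<^sub>R y - z) = s *\<^sub>R (A *v (x - z)) + t *\<^sub>R (A *v (y - z))"
    proof -
      have "s *\<^sub>R x + t *\<^sub>R y - z = s *\<^sub>R (x - z) + t *\<^sub>R (y - z)"
        using st(3) by (simp add: algebra_simps) (metis scaleR_left_distrib scaleR_one)
      then show ?thesis
        by (simp add: matrix_vector_right_distrib matrix_vector_mult_scaleR)
    qed
    moreover have "G ((s *\<^sub>R x + t *\<^sub>R y) $ i) i = 0" for i
    proof -
      have "G ((s *\<^sub>R x + t *\<^sub>R y) $ i) i \<le> s * G (x $ i) i + t * G (y $ i) i"
        using tilted_abs_sublinear[of \<mu> s t "x $ i" "y $ i" "h $ i"] st \<open>\<mu> > 0\<close> by (simp add: G_def)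
      then show ?thesis
        using x y G_nonneg[of "(s *\<^sub>R x + t *\<^sub>R y) $ i" i] by (simp add: min_iff)
    qed
    ultimately show "s *\<^sub>R x + t *\<^sub>R y \<in> minimizers F"
      using x y by (simp add: min_iff)
  qed
  have "closed (minimizers F)"
  proof -
    have "minimizers F = {x. A *v (x - z) = 0} \<inter> (\<Inter>i. {x. G (x $ i) i = 0})"
      using min_iff by auto
    moreover have "closed {x. A *v (x - z) = 0}"
      unfolding matrix_vector_mult_diff_distrib by (intro closed_Collect_eq continuous_intros)
    moreover have "closed {x :: real ^ 'n. G (x $ i) i = 0}" for i
      unfolding G_def by (intro closed_Collect_eq continuous_intros)
    ultimately show ?thesis
      by (simp only:) (intro closed_Int closed_INT ballI)
  qed
  define T where "T J = {w. A *v w = 0 \<and> (\<forall>i\<in>J. \<mu> * \<bar>w $ i\<bar> = h $ i * w $ i)}" for J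
  have "\<exists>C. \<forall>J. C J > 0 \<and> (\<forall>v. (\<forall>w\<in>T J. v \<bullet> w \<le> 0) \<longrightarrow> C J * (norm v)\<^sup>2
      \<le> 1 / 2 * (norm (A *v v))\<^sup>2 + (\<Sum>i\<in>J. (G (v $ i) i)\<^sup>2))"
    unfolding T_def G_def by (intro choice allI quadratic_lower_bound_on_polar)
  then obtain C where C_pos: "\<And>J. C J > 0"
    and C: "\<And>J v. \<forall>w\<in>T J. v \<bullet> w \<le> 0 \<Longrightarrow> C J * (norm v)\<^sup>2
      \<le> 1 / 2 * (norm (A *v v))\<^sup>2 + (\<Sum>i\<in>J. (G (v $ i) i)\<^sup>2)"
    by blast
  define c where "c = Min (range C)"
  have "c > 0" "\<And>J. c \<le> C J"
    using C_pos by (auto simp: c_def)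
  have "\<exists>p\<in>minimizers F. c * (norm (x - p))\<^sup>2 \<le> F x - F p"
    if xs: "xs \<in> minimizers F" "norm (x - xs) \<le> 1 / (2 * \<mu>)" for x xs
  proof -
    define p where "p = closest_point (minimizers F) x"
    define v where "v = x - p"
    define J where "J = {i. p $ i = 0}"
    have p: "p \<in> minimizers F"
      unfolding p_def by (rule closest_point_in_set) fact+
    have "norm v \<le> 1 / (2 * \<mu>)"
      using closest_point_le[OF \<open>closed _\<close> xs(1), of x] xs(2) by (simp add: v_def p_def dist_norm)
    have "\<forall>w\<in>T J. v \<bullet> w \<le> 0"
    proof
      fix w assume w: "w \<in> T J"
      obtain \<epsilon> where "\<epsilon> > 0" "\<forall>i. G ((p + \<epsilon> *\<^sub>R w) $ i) i = 0"
        using polyhedral_face_tangent[of \<mu> p h w] p w min_iff by (auto simp: T_def J_def G_def)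
      moreover have "A *v (p + \<epsilon> *\<^sub>R w - z) = A *v (p - z) + \<epsilon> *\<^sub>R (A *v w)"
        by (simp add: algebra_simps)
      ultimately have "p + \<epsilon> *\<^sub>R w \<in> minimizers F"
        using p w by (simp add: min_iff T_def)
      then have "v \<bullet> (\<epsilon> *\<^sub>R w) \<le> 0"
        using closest_point_dot[OF \<open>convex _\<close> \<open>closed _\<close>, of "p + \<epsilon> *\<^sub>R w" x]
        by (simp add: v_def p_def)
      then show "v \<bullet> w \<le> 0"
        using \<open>\<epsilon> > 0\<close> by (simp add: mult_le_0_iff)
    qed
    have "c * (norm v)\<^sup>2 \<le> C J * (norm v)\<^sup>2"
      using \<open>\<And>J. c \<le> C J\<close> by (simp add: mult_right_mono)
    also have "\<dots> \<le> 1 / 2 * (norm (A *v v))\<^sup>2 + (\<Sum>i\<in>J. (G (v $ i) i)\<^sup>2)"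
      by (rule C) fact
    also have "(\<Sum>i\<in>J. (G (v $ i) i)\<^sup>2) \<le> (\<Sum>i\<in>J. G (v $ i) i)"
    proof (rule sum_mono)
      fix i
      have "G (v $ i) i \<le> 2 * \<mu> * \<bar>v $ i\<bar>"
        using G_nonneg[of "- v $ i" i] by (simp add: G_def)
      also have "\<dots> \<le> 2 * \<mu> * (1 / (2 * \<mu>))"
        using \<open>norm v \<le> _\<close> component_le_norm_cart[of v i] \<open>\<mu> > 0\<close> by (intro mult_left_mono) auto
      finally have "G (v $ i) i \<le> 1"
        using \<open>\<mu> > 0\<close> by simp
      then show "(G (v $ i) i)\<^sup>2 \<le> G (v $ i) i"
        using G_nonneg[of "v $ i" i] by (simp add: power2_eq_square mult_left_le)
    qed
    also have "(\<Sum>i\<in>J. G (v $ i) i) = (\<Sum>i\<in>J. G (x $ i) i)"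
      by (rule sum.cong) (auto simp: v_def J_def)
    also have "\<dots> \<le> (\<Sum>i\<in>UNIV. G (x $ i) i)"
      using G_nonneg by (intro sum_mono2) auto
    also have "A *v v = A *v (x - z)"
    proof -
      have "A *v p = A *v z"
        using p by (simp add: min_iff algebra_simps)
      then show ?thesis by (simp add: v_def algebra_simps)
    qed
    also have "1 / 2 * (norm (A *v (x - z)))\<^sup>2 + (\<Sum>i\<in>UNIV. G (x $ i) i) = F x - F p"
      using excess[of x] F_min[OF p] by simp
    finally show ?thesis
      using p by (auto simp: v_def)
  qed
  with \<open>c > 0\<close> \<open>\<mu> > 0\<close> show ?thesis
    by (intro exI[of _ c] conjI exI[of _ "1 / (2 * \<mu>)"]) auto
qed

section \<open>Linear convergence of ISTA\<close>

text \<open>Monotonicity passes to the limit, \<open>\<parallel>xs - y\<parallel> \<le> \<parallel>x k - y\<parallel>\<close>; then use the triangle inequality. Thus the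
  distance to a single point, the limit, is controlled by the distance to the nearest
  minimizer.\<close>

lemma fejer_limit_distance:
  fixes x :: "nat \<Rightarrow> 'a::real_normed_vector"
  assumes "\<And>k. norm (x (Suc k) - y) \<le> norm (x k - y)" "x \<longlonglongrightarrow> xs"
  shows "norm (x k - xs) \<le> 2 * norm (x k - y)"
proof -
  have "decseq (\<lambda>k. norm (x k - y))"
    by (rule decseq_SucI) (rule assms)
  moreover have "(\<lambda>k. norm (x k - y)) \<longlonglongrightarrow> norm (xs - y)"
    by (intro tendsto_intros assms)
  ultimately have "norm (xs - y) \<le> norm (x k - y)"
    by (rule decseq_ge)
  then show ?thesis
    using norm_triangle_ineq4[of "x k - y" "xs - y"] by simp
qed

lemma growth_const_bounds:
  fixes A :: "real ^ 'n ^ 'm"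
  assumes "\<mu> > 0" "R \<ge> 0"
  shows "0 \<le> growth_const A b \<mu> \<nu> R" "growth_const A b \<mu> \<nu> R \<le> \<nu>\<^sup>2"
proof -
  define D where "D = 1 + sqrt 5 / 2 * \<mu> * R
    + (R * onorm ((*v) A) + norm b) * (4 * R * onorm ((*v) A) + norm b)"
  have "onorm ((*v) A) \<ge> 0"
    by (rule onorm_pos_le) (rule matrix_vector_mul_bounded_linear)
  then have "D \<ge> 1"
    using assms by (simp add: D_def)
  then have "0 \<le> inverse D" "inverse D \<le> 1"
    by (simp_all add: inverse_le_1_iff)
  moreover have "growth_const A b \<mu> \<nu> R = \<nu>\<^sup>2 * inverse D"
    by (simp add: growth_const_def D_def Let_def)
  ultimately show "0 \<le> growth_const A b \<mu> \<nu> R" "growth_const A b \<mu> \<nu> R \<le> \<nu>\<^sup>2"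
    by (simp_all add: mult_left_le)
qed

theorem corollary5p11:
  fixes A :: "real ^ 'n ^ 'm" and b :: "real ^ 'm" and \<mu> :: real
  assumes "\<mu> > 0"
  shows "\<exists>\<nu>>0. \<forall>(\<sigma>::real) (\<theta>::real) (x0::real ^ 'n) (xstar::real ^ 'n) (R::real).
    \<sigma> > 0 \<longrightarrow> 0 < \<theta> \<longrightarrow> \<theta> < 1 \<longrightarrow>
    xstar \<in> minimizers (lasso A b \<mu>) \<longrightarrow>
    ista A b \<mu> \<sigma> \<theta> x0 \<longlonglongrightarrow> xstar \<longrightarrow>
    R > (norm b)\<^sup>2 / (2 * \<mu>) \<longrightarrow>
    (let x = ista A b \<mu> \<sigma> \<theta> x0;
         F = lasso A b \<mu>;
         \<alpha> = step_bound A \<sigma> \<theta>;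
         \<gamma> = growth_const A b \<mu> \<nu> R
     in \<forall>\<^sub>F k in sequentially.
          norm (x (Suc k) - xstar) \<le> 1 / sqrt (1 + \<alpha> * \<gamma> / 4) * norm (x k - xstar) \<and>
          \<bar>F (x (Suc k)) - F xstar\<bar> \<le>
            (sqrt (1 + \<alpha> * \<gamma> / 4) + 1) / (2 * sqrt (1 + \<alpha> * \<gamma> / 4)) * \<bar>F (x k) - F xstar\<bar>)"
proof -
  define F where "F = lasso A b \<mu>"
  obtain c \<delta> where "c > 0" "\<delta> > 0"
    and growth: "\<And>x xs. xs \<in> minimizers F \<Longrightarrow> norm (x - xs) \<le> \<delta> \<Longrightarrow>
      \<exists>p\<in>minimizers F. c * (norm (x - p))\<^sup>2 \<le> F x - F p"
    using lasso_local_quadratic_growth[OF assms, of A b] unfolding F_def by blast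
  show ?thesis
  proof (intro exI[of _ "sqrt c"] conjI allI impI)
    show "sqrt c > 0" using \<open>c > 0\<close> by simp
  next
    fix \<sigma> \<theta> R :: real and x0 xstar :: "real ^ 'n"
    assume params: "\<sigma> > 0" "0 < \<theta>" "\<theta> < 1"
      and xstar: "xstar \<in> minimizers (lasso A b \<mu>)"
      and lim: "ista A b \<mu> \<sigma> \<theta> x0 \<longlonglongrightarrow> xstar"
      and R: "R > (norm b)\<^sup>2 / (2 * \<mu>)"
    define x where "x = ista A b \<mu> \<sigma> \<theta> x0"
    define \<alpha> where "\<alpha> = step_bound A \<sigma> \<theta>"
    define \<gamma> where "\<gamma> = growth_const A b \<mu> (sqrt c) R"
    define r where "r = sqrt (1 + \<alpha> * \<gamma> / 4)"
    have "(norm b)\<^sup>2 / (2 * \<mu>) \<ge> 0"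
      using assms by simp
    with R have "R \<ge> 0" by linarith
    then have \<gamma>: "0 \<le> \<gamma>" "\<gamma> \<le> c"
      using growth_const_bounds[OF assms \<open>R \<ge> 0\<close>, of A b "sqrt c"] \<open>c > 0\<close> by (auto simp: \<gamma>_def)
    have "\<alpha> > 0"
      using step_bound_admissible(1)[OF params(1,2)] by (simp add: \<alpha>_def)
    have r2: "r\<^sup>2 = 1 + \<alpha> * \<gamma> / 4" and "r \<ge> 1"
      using \<gamma> \<open>\<alpha> > 0\<close> by (simp_all add: r_def)
    have xstar: "xstar \<in> minimizers F" and lim: "x \<longlonglongrightarrow> xstar"
      using xstar lim by (simp_all add: F_def x_def)
    have step: "\<exists>a\<ge>2 * \<alpha>. \<forall>y. (norm (x (Suc k) - y))\<^sup>2 + 2 * a * (F (x (Suc k)) - F y)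
        \<le> (norm (x k - y))\<^sup>2" for k
      unfolding F_def x_def \<alpha>_def by (rule ista_step[OF assms params])
    have fejer: "norm (x (Suc k) - y) \<le> norm (x k - y)" if "y \<in> minimizers F" for k y
    proof -
      obtain a where "a \<ge> 2 * \<alpha>"
          "(norm (x (Suc k) - y))\<^sup>2 + 2 * a * (F (x (Suc k)) - F y) \<le> (norm (x k - y))\<^sup>2"
        using step by blast
      moreover have "F y \<le> F (x (Suc k))"
        using that by (simp add: minimizers_def)
      then have "0 \<le> 2 * a * (F (x (Suc k)) - F y)"
        using \<open>a \<ge> 2 * \<alpha>\<close> \<open>\<alpha> > 0\<close> by simp
      ultimately have "(norm (x (Suc k) - y))\<^sup>2 \<le> (norm (x k - y))\<^sup>2"
        by linarith
      then show ?thesis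
        by (rule power2_le_imp_le) simp
    qed
    have growth_at_limit: "c / 4 * (norm (x k - xstar))\<^sup>2 \<le> F (x k) - F xstar"
      if near: "norm (x k - xstar) \<le> \<delta>" for k
    proof -
      obtain p where p: "p \<in> minimizers F" "c * (norm (x k - p))\<^sup>2 \<le> F (x k) - F p"
        using growth[OF xstar near] by blast
      have "(norm (x k - xstar))\<^sup>2 \<le> (2 * norm (x k - p))\<^sup>2"
        by (rule power_mono[OF fejer_limit_distance[OF fejer[OF p(1)] lim]]) simp
      then have "c / 4 * (norm (x k - xstar))\<^sup>2 \<le> c / 4 * (2 * norm (x k - p))\<^sup>2"
        using \<open>c > 0\<close> by (intro mult_left_mono) auto
      also have "\<dots> = c * (norm (x k - p))\<^sup>2"
        by (simp add: power_mult_distrib)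
      also have "F p = F xstar"
        using p(1) xstar by (intro order_antisym) (auto simp: minimizers_def)
      note p(2)[unfolded this]
      finally show ?thesis .
    qed
    have "eventually (\<lambda>k. dist (x (Suc k)) xstar < \<delta>) sequentially"
      using LIMSEQ_Suc[OF lim] \<open>\<delta> > 0\<close> by (rule tendstoD)
    then have "\<forall>\<^sub>F k in sequentially. norm (x (Suc k) - xstar) \<le> 1 / r * norm (x k - xstar) \<and>
      \<bar>F (x (Suc k)) - F xstar\<bar> \<le> (r + 1) / (2 * r) * \<bar>F (x k) - F xstar\<bar>"
    proof eventually_elim
      case (elim k)
      define d where "d = norm (x (Suc k) - xstar)"
      define e where "e = norm (x k - xstar)"
      define s where "s = norm (x k - x (Suc k))"
      define \<Phi> where "\<Phi> = F (x k) - F xstar"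
      define \<Phi>' where "\<Phi>' = F (x (Suc k)) - F xstar"
      have nonneg: "\<Phi> \<ge> 0" "\<Phi>' \<ge> 0"
        using xstar by (auto simp: \<Phi>_def \<Phi>'_def minimizers_def)
      obtain a where "a \<ge> 2 * \<alpha>"
        and a: "\<And>y. (norm (x (Suc k) - y))\<^sup>2 + 2 * a * (F (x (Suc k)) - F y) \<le> (norm (x k - y))\<^sup>2"
        using step by blast
      have "d\<^sup>2 + 2 * a * \<Phi>' \<le> e\<^sup>2"
        using a[of xstar] by (simp add: d_def e_def \<Phi>'_def)
      have "s\<^sup>2 + 2 * a * \<Phi>' \<le> 2 * a * \<Phi>"
        using a[of "x k"] by (simp add: s_def \<Phi>_def \<Phi>'_def norm_minus_commute algebra_simps)
      have "e \<le> d + s"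
        using norm_triangle_ineq[of "x (Suc k) - xstar" "x k - x (Suc k)"]
        by (simp add: d_def e_def s_def)
      have "c / 4 * d\<^sup>2 \<le> \<Phi>'"
        using growth_at_limit[of "Suc k"] elim by (simp add: d_def \<Phi>'_def dist_norm)
      have "(r\<^sup>2 - 1) * d\<^sup>2 = \<alpha> * (\<gamma> / 4 * d\<^sup>2)"
        by (simp add: r2)
      also have "\<dots> \<le> \<alpha> * (c / 4 * d\<^sup>2)"
        using \<gamma> \<open>\<alpha> > 0\<close> by (intro mult_left_mono mult_right_mono) auto
      also have "\<dots> \<le> \<alpha> * \<Phi>'"
        using \<open>\<alpha> > 0\<close> \<open>c / 4 * d\<^sup>2 \<le> \<Phi>'\<close> by (intro mult_left_mono) auto
      also have "\<dots> \<le> 2 * a * \<Phi>'"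
        using \<open>a \<ge> 2 * \<alpha>\<close> \<open>\<alpha> > 0\<close> nonneg by (intro mult_right_mono) auto
      finally have "(r\<^sup>2 - 1) * d\<^sup>2 \<le> 2 * a * \<Phi>'" .
      \<comment> \<open>\<open>r\<^sup>2 d\<^sup>2 = d\<^sup>2 + (r\<^sup>2 - 1) d\<^sup>2\<close>, and the Fejer inequality bounds this by \<open>e\<^sup>2\<close>\<close>
      have "(r * d)\<^sup>2 \<le> e\<^sup>2"
        using \<open>(r\<^sup>2 - 1) * d\<^sup>2 \<le> 2 * a * \<Phi>'\<close> \<open>d\<^sup>2 + 2 * a * \<Phi>' \<le> e\<^sup>2\<close>
        by (simp add: power_mult_distrib algebra_simps)
      then have "r * d \<le> e"
        by (rule power2_le_imp_le) (simp add: e_def)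
      then have "d \<le> 1 / r * e"
        using \<open>r \<ge> 1\<close> by (simp add: field_simps)
      moreover have "\<Phi>' \<le> (r + 1) / (2 * r) * \<Phi>"
      proof (rule function_value_contraction[where d = d and e = e and s = s])
        show "0 < a" using \<open>a \<ge> 2 * \<alpha>\<close> \<open>\<alpha> > 0\<close> by linarith
      qed (fact | simp add: d_def e_def s_def)+
      ultimately show ?case
        using nonneg by (simp add: d_def e_def \<Phi>_def \<Phi>'_def)
    qed
    then show "let x = ista A b \<mu> \<sigma> \<theta> x0; F = lasso A b \<mu>; \<alpha> = step_bound A \<sigma> \<theta>;
        \<gamma> = growth_const A b \<mu> (sqrt c) R
      in \<forall>\<^sub>F k in sequentially.
          norm (x (Suc k) - xstar) \<le> 1 / sqrt (1 + \<alpha> * \<gamma> / 4) * norm (x k - xstar) \<and>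
          \<bar>F (x (Suc k)) - F xstar\<bar> \<le>
            (sqrt (1 + \<alpha> * \<gamma> / 4) + 1) / (2 * sqrt (1 + \<alpha> * \<gamma> / 4)) * \<bar>F (x k) - F xstar\<bar>"
      unfolding Let_def x_def F_def r_def \<alpha>_def \<gamma>_def .
  qed
qed

end
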